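(* Let $(G,u)\in\mathbf{W}^*$, i.e. $G$ is an Archimedean $\ell$-group and $u\geq 0$ is a strong unit of $G$, regarded as $G\le C(YG)$ via the Yosida representation. The following are equivalent: (1) $G\in(\mathrm{M})$, i.e. $G(g)=g^{\perp\perp}$ for all $g\in G$. (2) For all $g\in G$, $G(g)$ is a $d$-ideal. (3) For all $f,g\in G$, if $\mathrm{coz}(f)\subseteq\overline{\mathrm{coz}(g)}$, then $f\in G(g)$. (4) For all $g\in G$, $G/G(g)$ is Archimedean, and in $G$ every weak unit is a strong unit.
   Context: An ideal of an abelian $\ell$-group $G$ is a convex sub-$\ell$-group. For $g\in G$: $G(g)=\{f\in G : |f|\le n|g| \text{ for some positive integer } n\}$; $g^\perp=\{f\in G: |f|\wedge|g|=0\}$; for $S\subseteq G$, $S^\perp=\bigcap_{s\in S}s^\perp$; and $g^{\perp\perp}=(g^\perp)^\perp$. A weak unit is an element $v\ge0$ with $v^\perp=\{0\}$; a strong unit is an element $v\ge 0$ with $G(v)=G$. An ideal $I$ is a $d$-ideal if $g\in I$ implies $g^{\perp\perp}\subseteq I$. $YG=Y(G,u)$ is the set of ideals of $G$ maximal with respect to not containing $u$ (these are the proper maximal ideals), with the hull-kernel topology; it is compact Hausdorff. For $M\in YG$ there is a unique embedding $G/M\to\mathbb{R}$ of $\ell$-groups taking $u+M$ to $1$, and $g(M)$ denotes the image of $g+M$; this gives the (Yosida) embedding $G\le C(YG)$ with $u\mapsto 1$, whose image $0$-$1$ separates disjoint closed sets of $YG$. Then $\mathrm{coz}(g)=\{x\in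 YG: g(x)\ne0\}$, and closures are taken in $YG$. *)

theory Defs
  imports "HOL-Analysis.Analysis" "HOL-Library.Lattice_Algebras" "HOL-Library.Set_Algebras"
begin

(* An abelian l-group is a type of class lattice_ab_group_add_abs.  Its quotients are sets of
   cosets g +o I, added by the sum of sets from Set_Algebras. *)

definition nat_mult :: "nat \<Rightarrow> 'a::comm_monoid_add \<Rightarrow> 'a" where
  "nat_mult n x = (\<Sum>i<n. x)"

(* The carrier A, the neutral element z and the order le are arguments, so that the notion applies
   both to an l-group and to its quotients; the addition is the one of the ambient type.
   In a quotient by I the neutral element is the coset I, not the 0 = {0} of Set_Algebras;
   nat_mult is used for n > 0 only. *)
definition archimedean_lgroup :: "'b::comm_monoid_add set \<Rightarrow> 'b \<Rightarrow> ('b \<Rightarrow> 'b \<Rightarrow> bool) \<Rightarrow> bool" where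
  "archimedean_lgroup A z le \<longleftrightarrow>
     (\<forall>a\<in>A. \<forall>b\<in>A. le z a \<and> (\<forall>n>0. le (nat_mult n a) b) \<longrightarrow> a = z)"

definition lideal :: "'a::lattice_ab_group_add_abs set \<Rightarrow> bool" where
  "lideal I \<longleftrightarrow> 0 \<in> I
     \<and> (\<forall>a\<in>I. \<forall>b\<in>I. a - b \<in> I \<and> sup a b \<in> I \<and> inf a b \<in> I)
     \<and> (\<forall>a\<in>I. \<forall>b\<in>I. \<forall>x. a \<le> x \<and> x \<le> b \<longrightarrow> x \<in> I)"

(* G(g) *)
definition principal_lideal :: "'a::lattice_ab_group_add_abs \<Rightarrow> 'a set" where
  "principal_lideal g = {f. \<exists>n>0. \<bar>f\<bar> \<le> nat_mult n \<bar>g\<bar>}"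

definition perp :: "'a::lattice_ab_group_add_abs \<Rightarrow> 'a set" where
  "perp g = {f. inf \<bar>f\<bar> \<bar>g\<bar> = 0}"

definition set_perp :: "'a::lattice_ab_group_add_abs set \<Rightarrow> 'a set" where
  "set_perp S = (\<Inter>s\<in>S. perp s)"

definition weak_unit :: "'a::lattice_ab_group_add_abs \<Rightarrow> bool" where
  "weak_unit v \<longleftrightarrow> 0 \<le> v \<and> perp v = {0}"

definition strong_unit :: "'a::lattice_ab_group_add_abs \<Rightarrow> bool" where
  "strong_unit v \<longleftrightarrow> 0 \<le> v \<and> principal_lideal v = UNIV"

definition d_ideal :: "'a::lattice_ab_group_add_abs set \<Rightarrow> bool" where
  "d_ideal I \<longleftrightarrow> lideal I \<and> (\<forall>g\<in>I. set_perp (perp g) \<subseteq> I)"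

definition quotient_carrier :: "'a::lattice_ab_group_add_abs set \<Rightarrow> 'a set set" where
  "quotient_carrier I = {g +o I |g. True}"

definition quotient_le :: "'a::lattice_ab_group_add_abs set \<Rightarrow> 'a set \<Rightarrow> bool" where
  "quotient_le X Y \<longleftrightarrow> (\<exists>x\<in>X. \<exists>y\<in>Y. x \<le> y)"

definition yosida_space :: "'a::lattice_ab_group_add_abs \<Rightarrow> 'a set set" where
  "yosida_space u = {M. lideal M \<and> u \<notin> M \<and> (\<forall>N. lideal N \<and> u \<notin> N \<and> M \<subseteq> N \<longrightarrow> N = M)}"

(* The hull-kernel topology: the sets below are the complements of the hulls of single elements. *)
definition hull_kernel_topology :: "'a::lattice_ab_group_add_abs \<Rightarrow> 'a set topology" where
  "hull_kernel_topology u = topology_generated_by {{M \<in> yosida_space u. g \<notin> M} |g. True}"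

(* An embedding of l-groups G/M \<rightarrow> \<real> with u + M \<mapsto> 1; the lattice operations of G/M are
   (f + M) \<or> (g + M) = (f \<or> g) + M and (f + M) \<and> (g + M) = (f \<and> g) + M. *)
definition yosida_embedding ::
  "'a::lattice_ab_group_add_abs \<Rightarrow> 'a set \<Rightarrow> ('a set \<Rightarrow> real) \<Rightarrow> bool" where
  "yosida_embedding u M \<phi> \<longleftrightarrow>
     inj_on \<phi> (quotient_carrier M)
     \<and> (\<forall>f g. \<phi> ((f +o M) + (g +o M)) = \<phi> (f +o M) + \<phi> (g +o M)
            \<and> \<phi> (sup f g +o M) = sup (\<phi> (f +o M)) (\<phi> (g +o M))
            \<and> \<phi> (inf f g +o M) = inf (\<phi> (f +o M)) (\<phi> (g +o M)))
     \<and> \<phi> (u +o M) = 1"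

(* g(M).  The embedding is unique on G/M only, not as a function on all sets, hence the
   description of its value at g + M. *)
definition yosida_value :: "'a::lattice_ab_group_add_abs \<Rightarrow> 'a \<Rightarrow> 'a set \<Rightarrow> real" where
  "yosida_value u g M = (THE r. \<exists>\<phi>. yosida_embedding u M \<phi> \<and> r = \<phi> (g +o M))"

definition coz :: "'a::lattice_ab_group_add_abs \<Rightarrow> 'a \<Rightarrow> 'a set set" where
  "coz u g = {M \<in> yosida_space u. yosida_value u g M \<noteq> 0}"

end

theory Submission
  imports Defs
begin

text \<open>Always \<open>g \<in> G(g) \<subseteq> g\<^sup>\<bottom>\<^sup>\<bottom>\<close>, so (1) and (2) both say that \<open>g\<^sup>\<bottom>\<^sup>\<bottom> \<subseteq> G(g)\<close>.
  For (3), a maximal ideal \<open>M\<close> is prime and \<open>G/M\<close> is totally ordered with every nonzero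
  positive element a strong unit, so Hoelder's theorem embeds it into the reals and
  \<open>coz(g)\<close> consists of the \<open>M\<close> not containing \<open>g\<close>.  Since \<open>G\<close> is Archimedean, these cozero sets
  form a base in which disjointness means disjointness in \<open>G\<close>; hence
  \<open>coz(f)\<close> lies in the closure of \<open>coz(g)\<close> exactly when \<open>f\<close> lies in \<open>g\<^sup>\<bottom>\<^sup>\<bottom>\<close>.
  For (4), the quotient of an Archimedean group by a polar is Archimedean.  Conversely, if \<open>f\<close> lies
  in \<open>g\<^sup>\<bottom>\<^sup>\<bottom>\<close>, then \<open>\<bar>g\<bar> + (u - n \<bar>f\<bar>)\<^sup>+\<close> is a weak unit and hence strong; so \<open>(u - n \<bar>f\<bar>)\<^sup>+\<close> is
  a strong unit modulo \<open>G(g)\<close>, that is, \<open>n \<bar>f\<bar> \<le> u\<close> modulo \<open>G(g)\<close>, for every \<open>n\<close>, and \<open>f\<close> is in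
  \<open>G(g)\<close> because the quotient is Archimedean.\<close>

section \<open>Multiples and disjoint elements\<close>

lemma nat_mult_0 [simp]: "nat_mult 0 x = 0"
  by (simp add: nat_mult_def)

lemma nat_mult_Suc: "nat_mult (Suc n) x = nat_mult n x + x"
  by (simp add: nat_mult_def)

lemma nat_mult_1 [simp]: "nat_mult (Suc 0) x = x"
  by (simp add: nat_mult_Suc)

lemma nat_mult_zero_right [simp]: "nat_mult n 0 = 0"
  by (simp add: nat_mult_def)

lemma nat_mult_distrib_left: "nat_mult n (x + y) = nat_mult n x + nat_mult n y"
  by (simp add: nat_mult_def sum.distrib)

lemma nat_mult_distrib_right: "nat_mult (m + n) x = nat_mult m x + nat_mult n x"
  by (induction n) (simp_all add: nat_mult_Suc add.assoc)

lemma nat_mult_mult: "nat_mult (m * n) x = nat_mult m (nat_mult n x)"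
  by (induction m) (simp_all add: nat_mult_Suc nat_mult_distrib_right add.commute)

lemma nat_mult_swap: "nat_mult m (nat_mult n x) = nat_mult n (nat_mult m x)"
  by (simp add: mult.commute flip: nat_mult_mult)

lemma nat_mult_mono:
  fixes x y :: "'a::ordered_ab_group_add"
  shows "x \<le> y \<Longrightarrow> nat_mult n x \<le> nat_mult n y"
  by (simp add: nat_mult_def sum_mono)

lemma nat_mult_nonneg:
  fixes x :: "'a::ordered_ab_group_add"
  shows "0 \<le> x \<Longrightarrow> 0 \<le> nat_mult n x"
  by (simp add: nat_mult_def sum_nonneg)

lemma nat_mult_mono_left:
  fixes x :: "'a::ordered_ab_group_add"
  assumes "m \<le> n" "0 \<le> x"
  shows "nat_mult m x \<le> nat_mult n x"
proof -
  from assms(1) obtain k where "n = m + k"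
    using le_Suc_ex by blast
  then show ?thesis
    by (simp add: nat_mult_distrib_right nat_mult_nonneg assms(2))
qed

text \<open>The left side lies below both \<open>a + inf a c\<close> and \<open>b + inf a c\<close>,
  and the infimum of these two is the right side. All later arguments about disjoint elements rest
  on this inequality.\<close>

lemma inf_add_le:
  fixes a b c :: "'a::lattice_ab_group_add"
  assumes "0 \<le> a" "0 \<le> b" "0 \<le> c"
  shows "inf a (b + c) \<le> inf a b + inf a c"
proof -
  have "inf a (b + c) \<le> a + inf a c"
    by (rule le_infI1) (simp add: assms)
  moreover have "inf a (b + c) \<le> b + inf a c"
  proof -
    have "inf a (b + c) \<le> inf (b + a) (b + c)"
      using add_increasing[OF assms(2) order_refl] by (intro inf_mono) auto
    then show ?thesis by (simp add: add_inf_distrib_left)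
  qed
  ultimately show ?thesis by (simp add: add_inf_distrib_right)
qed

lemma inf_add_eq_0:
  fixes a b c :: "'a::lattice_ab_group_add"
  assumes "0 \<le> a" "0 \<le> b" "0 \<le> c" "inf a b = 0" "inf a c = 0"
  shows "inf a (b + c) = 0"
proof (rule antisym)
  show "inf a (b + c) \<le> 0"
    using inf_add_le[OF assms(1,2,3)] assms(4,5) by simp
qed (simp add: assms)

lemma inf_eq_0_mono:
  fixes a b :: "'a::lattice_ab_group_add"
  assumes "inf a b = 0" "0 \<le> a'" "a' \<le> a" "0 \<le> b'" "b' \<le> b"
  shows "inf a' b' = 0"
proof (rule antisym)
  show "inf a' b' \<le> 0"
    using inf_mono[OF assms(3,5)] assms(1) by simp
qed (simp add: assms)

lemma inf_nat_mult_eq_0: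
  fixes a b :: "'a::lattice_ab_group_add"
  assumes "0 \<le> a" "0 \<le> b" "inf a b = 0"
  shows "inf a (nat_mult n b) = 0"
proof (induction n)
  case 0
  then show ?case using assms(1) by (simp add: inf_absorb2)
next
  case (Suc n)
  then show ?case
    unfolding nat_mult_Suc using assms by (intro inf_add_eq_0 nat_mult_nonneg)
qed

lemma inf_nat_mult2_eq_0:
  fixes a b :: "'a::lattice_ab_group_add"
  assumes "0 \<le> a" "0 \<le> b" "inf a b = 0"
  shows "inf (nat_mult m a) (nat_mult n b) = 0"
  using inf_nat_mult_eq_0[of "nat_mult n b" a m] inf_nat_mult_eq_0[OF assms, of n] assms
  by (simp add: inf_commute nat_mult_nonneg)

text \<open>Writing \<open>pprt x\<close> as \<open>x + pprt (- x)\<close>, the common summand can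
  be pulled out of the infimum, and what remains is \<open>inf x 0\<close>, the negative of
  \<open>pprt (- x)\<close>.\<close>

lemma inf_pprt_pprt_uminus:
  fixes x :: "'a::lattice_ab_group_add"
  shows "inf (pprt x) (pprt (- x)) = 0"
proof -
  have "pprt x = x + pprt (- x)"
    using prts[of x] by (simp add: pprt_neg algebra_simps)
  then have "inf (pprt x) (pprt (- x)) = inf x 0 + pprt (- x)"
    by (simp add: add_inf_distrib_right)
  then show ?thesis
    by (simp add: pprt_neg flip: nprt_def)
qed

lemma le_pprt: "x \<le> pprt x" for x :: "'a::lattice_ab_group_add"
  by (simp add: pprt_def)

section \<open>Ideals\<close>

text \<open>Serves both for G(g) and for the ideal generated by a maximal ideal and one more
  element. Each closure condition reduces to \<open>key\<close>, since differences, suprema, infima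
  and elements between \<open>a\<close> and \<open>b\<close> are all bounded by \<bar>a\<bar> +
  \<bar>b\<bar> in absolute value.\<close>

lemma lideal_dominated:
  fixes B :: "'a::lattice_ab_group_add_abs set"
  assumes "b0 \<in> B" "0 \<le> b0" and sum: "\<And>b c. b \<in> B \<Longrightarrow> c \<in> B \<Longrightarrow> \<exists>d\<in>B. b + c \<le> d"
  shows "lideal {x. \<exists>b\<in>B. \<bar>x\<bar> \<le> b}" (is "lideal ?I")
proof -
  have key: "x \<in> ?I" if "a \<in> ?I" "b \<in> ?I" "\<bar>x\<bar> \<le> \<bar>a\<bar> + \<bar>b\<bar>" for a b x
  proof -
    from that obtain c d where "c \<in> B" "d \<in> B" "\<bar>a\<bar> \<le> c" "\<bar>b\<bar> \<le> d" by auto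
    moreover obtain e where "e \<in> B" "c + d \<le> e"
      using sum \<open>c \<in> B\<close> \<open>d \<in> B\<close> by blast
    ultimately have "\<bar>x\<bar> \<le> e"
      using that(3) add_mono[of "\<bar>a\<bar>" c "\<bar>b\<bar>" d] by (meson order_trans)
    with \<open>e \<in> B\<close> show ?thesis by blast
  qed
  have bounds: "y \<le> \<bar>a\<bar> + \<bar>b\<bar>" if "y \<le> a \<or> y \<le> - a \<or> y \<le> b \<or> y \<le> - b" for a b y :: 'a
  proof -
    have "y \<le> \<bar>a\<bar> \<or> y \<le> \<bar>b\<bar>"
      using that abs_ge_self[of a] abs_ge_minus_self[of a] abs_ge_self[of b] abs_ge_minus_self[of b]
      by (blast intro: order_trans)
    then show ?thesis
      by (auto intro: add_increasing add_increasing2)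
  qed
  have sup_le: "\<bar>sup a b\<bar> \<le> \<bar>a\<bar> + \<bar>b\<bar>" and inf_le: "\<bar>inf a b\<bar> \<le> \<bar>a\<bar> + \<bar>b\<bar>" for a b :: 'a
  proof -
    have "sup a b \<le> \<bar>a\<bar> + \<bar>b\<bar>"
      by (rule le_supI) (rule bounds, simp)+
    moreover have "- sup a b \<le> \<bar>a\<bar> + \<bar>b\<bar>"
      by (rule bounds) simp
    ultimately show "\<bar>sup a b\<bar> \<le> \<bar>a\<bar> + \<bar>b\<bar>"
      by (rule abs_leI)
    have "inf a b \<le> \<bar>a\<bar> + \<bar>b\<bar>"
      by (rule bounds) simp
    moreover have "- inf a b \<le> \<bar>a\<bar> + \<bar>b\<bar>"
      unfolding neg_inf_eq_sup by (rule le_supI) (rule bounds, simp)+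
    ultimately show "\<bar>inf a b\<bar> \<le> \<bar>a\<bar> + \<bar>b\<bar>"
      by (rule abs_leI)
  qed
  have between: "\<bar>x\<bar> \<le> \<bar>a\<bar> + \<bar>b\<bar>" if "a \<le> x" "x \<le> b" for a b x :: 'a
    by (rule abs_leI) (rule bounds, simp add: that)+
  show ?thesis
    unfolding lideal_def
  proof (intro conjI ballI allI impI)
    show "0 \<in> ?I" using assms(1,2) by auto
  next
    fix a b assume ab: "a \<in> ?I" "b \<in> ?I"
    show "a - b \<in> ?I" by (rule key[OF ab abs_triangle_ineq4])
    show "sup a b \<in> ?I" by (rule key[OF ab sup_le])
    show "inf a b \<in> ?I" by (rule key[OF ab inf_le])
    show "x \<in> ?I" if "a \<le> x \<and> x \<le> b" for x
      using that by (intro key[OF ab between]) simp_all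
  qed
qed

lemma lideal_principal: "lideal (principal_lideal (g::'a::lattice_ab_group_add_abs))"
proof -
  have "lideal {x. \<exists>b\<in>{nat_mult n \<bar>g\<bar> |n. 0 < n}. \<bar>x\<bar> \<le> b}"
  proof (rule lideal_dominated[of "\<bar>g\<bar>"])
    show "\<bar>g\<bar> \<in> {nat_mult n \<bar>g\<bar> |n. 0 < n}"
      using nat_mult_1[of "\<bar>g\<bar>"] by (metis (mono_tags, lifting) mem_Collect_eq zero_less_Suc)
  next
    fix b c assume "b \<in> {nat_mult n \<bar>g\<bar> |n. 0 < n}" "c \<in> {nat_mult n \<bar>g\<bar> |n. 0 < n}"
    then obtain m n where "b = nat_mult m \<bar>g\<bar>" "c = nat_mult n \<bar>g\<bar>" "0 < m" by blast
    then have "b + c = nat_mult (m + n) \<bar>g\<bar>" "0 < m + n"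
      by (simp_all add: nat_mult_distrib_right)
    then show "\<exists>d\<in>{nat_mult n \<bar>g\<bar> |n. 0 < n}. b + c \<le> d"
      by (metis (mono_tags, lifting) mem_Collect_eq order_refl)
  qed simp
  moreover have "{x. \<exists>b\<in>{nat_mult n \<bar>g\<bar> |n. 0 < n}. \<bar>x\<bar> \<le> b} = principal_lideal g"
    unfolding principal_lideal_def by blast
  ultimately show ?thesis by simp
qed

lemma principal_lideal_self: "g \<in> principal_lideal g"
  unfolding principal_lideal_def
  by (auto intro!: exI[of _ "Suc 0"])

lemma lideal_zero: "lideal I \<Longrightarrow> 0 \<in> I"
  unfolding lideal_def by blast

lemma lideal_diff: "lideal I \<Longrightarrow> a \<in> I \<Longrightarrow> b \<in> I \<Longrightarrow> a - b \<in> I"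
  unfolding lideal_def by blast

lemma lideal_sup: "lideal I \<Longrightarrow> a \<in> I \<Longrightarrow> b \<in> I \<Longrightarrow> sup a b \<in> I"
  unfolding lideal_def by blast

lemma lideal_convex: "lideal I \<Longrightarrow> a \<in> I \<Longrightarrow> b \<in> I \<Longrightarrow> a \<le> x \<Longrightarrow> x \<le> b \<Longrightarrow> x \<in> I"
  unfolding lideal_def by blast

lemma lideal_uminus: "lideal I \<Longrightarrow> a \<in> I \<Longrightarrow> - a \<in> I"
  using lideal_diff[of I 0 a] lideal_zero[of I] by simp

lemma lideal_add: "lideal I \<Longrightarrow> a \<in> I \<Longrightarrow> b \<in> I \<Longrightarrow> a + b \<in> I"
  using lideal_diff[of I a "- b"] lideal_uminus[of I b] by simp

lemma lideal_abs: "lideal I \<Longrightarrow> a \<in> I \<Longrightarrow> \<bar>a\<bar> \<in> I"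
  by (simp add: abs_lattice lideal_sup lideal_uminus)

lemma lideal_abs_le: "lideal I \<Longrightarrow> \<bar>x\<bar> \<le> y \<Longrightarrow> y \<in> I \<Longrightarrow> x \<in> I"
  using abs_ge_self[of x] abs_ge_minus_self[of x]
  by (metis lideal_convex lideal_uminus minus_le_iff order_trans)

lemma lideal_abs_iff: "lideal I \<Longrightarrow> \<bar>x\<bar> \<in> I \<longleftrightarrow> x \<in> I"
  using lideal_abs lideal_abs_le by blast

lemma lideal_nonneg_le: "lideal I \<Longrightarrow> 0 \<le> x \<Longrightarrow> x \<le> y \<Longrightarrow> y \<in> I \<Longrightarrow> x \<in> I"
  using lideal_convex lideal_zero by blast

lemma lideal_nat_mult: "lideal I \<Longrightarrow> a \<in> I \<Longrightarrow> nat_mult n a \<in> I"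
  by (induction n) (simp_all add: nat_mult_Suc lideal_add lideal_zero)

lemma principal_lideal_subset: "lideal I \<Longrightarrow> g \<in> I \<Longrightarrow> principal_lideal g \<subseteq> I"
  unfolding principal_lideal_def
  by (auto intro: lideal_abs_le lideal_nat_mult lideal_abs)

section \<open>The order of a quotient, expressed on representatives\<close>

definition mod_le :: "'a::lattice_ab_group_add_abs set \<Rightarrow> 'a \<Rightarrow> 'a \<Rightarrow> bool" where
  "mod_le I a b \<longleftrightarrow> (\<exists>m\<in>I. a \<le> b + m)"

lemma mod_le_if_le: "lideal I \<Longrightarrow> a \<le> b \<Longrightarrow> mod_le I a b"
  unfolding mod_le_def by (rule bexI[of _ 0]) (simp_all add: lideal_zero)

lemma mod_le_trans: "lideal I \<Longrightarrow> mod_le I a b \<Longrightarrow> mod_le I b c \<Longrightarrow> mod_le I a c"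
proof -
  assume I: "lideal I" and "mod_le I a b" "mod_le I b c"
  then obtain m n where mn: "m \<in> I" "a \<le> b + m" "n \<in> I" "b \<le> c + n"
    unfolding mod_le_def by blast
  then have "a \<le> c + n + m"
    using add_right_mono order_trans by blast
  then show ?thesis
    unfolding mod_le_def using lideal_add[OF I mn(3,1)] by (auto simp: add.assoc)
qed

lemma mod_le_add: "lideal I \<Longrightarrow> mod_le I a b \<Longrightarrow> mod_le I c d \<Longrightarrow> mod_le I (a + c) (b + d)"
proof -
  assume I: "lideal I" and "mod_le I a b" "mod_le I c d"
  then obtain m n where mn: "m \<in> I" "a \<le> b + m" "n \<in> I" "c \<le> d + n"
    unfolding mod_le_def by blast
  then have "a + c \<le> b + d + (m + n)"
    using add_mono[OF mn(2,4)] by (simp add: algebra_simps)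
  then show ?thesis
    unfolding mod_le_def using lideal_add[OF I mn(1,3)] by blast
qed

lemma mod_le_add_right_cancel: "mod_le I (a + c) (b + c) \<longleftrightarrow> mod_le I a b"
proof -
  have "a + c \<le> b + c + m \<longleftrightarrow> a \<le> b + m" for m
    by (metis add.assoc add.commute add_le_cancel_right)
  then show ?thesis by (simp add: mod_le_def)
qed

lemma mod_le_diff_iff: "mod_le I (a - b) 0 \<longleftrightarrow> mod_le I a b"
  using mod_le_add_right_cancel[of I "a - b" b 0] by simp

lemma mod_le_nat_mult: "lideal I \<Longrightarrow> mod_le I a b \<Longrightarrow> mod_le I (nat_mult n a) (nat_mult n b)"
  by (induction n) (simp_all add: nat_mult_Suc mod_le_add mod_le_if_le)

text \<open>If x \<le> m with m in the ideal, then 0 \<le> \<open>pprt x\<close> \<le> \<bar>m\<bar>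
  and convexity applies; conversely \<open>pprt x\<close> itself bounds \<open>x\<close>. Order
  questions modulo an ideal thus become questions of membership.\<close>

lemma mod_le_zero_iff_pprt: "lideal I \<Longrightarrow> mod_le I x 0 \<longleftrightarrow> pprt x \<in> I"
  for x :: "'a::lattice_ab_group_add_abs"
proof
  assume I: "lideal I" and "mod_le I x 0"
  then obtain m where m: "m \<in> I" "x \<le> m" unfolding mod_le_def by auto
  then have "pprt x \<le> \<bar>m\<bar>"
    using abs_ge_self[of m] by (auto simp: pprt_def)
  then show "pprt x \<in> I"
    using lideal_nonneg_le[OF I zero_le_pprt] lideal_abs[OF I m(1)] by blast
next
  assume "lideal I" and "pprt x \<in> I"
  then show "mod_le I x 0"
    unfolding mod_le_def using le_pprt[of x] by auto
qed

lemma mod_le_iff_pprt: "lideal I \<Longrightarrow> mod_le I a b \<longleftrightarrow> pprt (a - b) \<in> I"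
  using mod_le_zero_iff_pprt mod_le_diff_iff by blast

section \<open>Cosets\<close>

lemma coset_eq_iff: "lideal I \<Longrightarrow> a +o I = b +o I \<longleftrightarrow> a - b \<in> I"
  for a b :: "'a::lattice_ab_group_add_abs"
proof
  assume I: "lideal I" and "a +o I = b +o I"
  moreover have "a \<in> a +o I"
    using lideal_zero[OF I] set_plus_intro2[of 0 I a] by simp
  ultimately show "a - b \<in> I"
    by (simp add: set_minus_plus)
next
  assume I: "lideal I" and ab: "a - b \<in> I"
  have "x - a \<in> I \<longleftrightarrow> x - b \<in> I" for x
    using lideal_add[OF I, of "x - a" "a - b"] lideal_diff[OF I, of "x - b" "a - b"] ab by auto
  then show "a +o I = b +o I"
    by (auto simp flip: set_minus_plus)
qed

lemma lideal_plus_self: "lideal I \<Longrightarrow> I + I = I"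
  using set_zero_plus2[of I I] lideal_zero[of I] by (auto elim!: set_plus_elim intro: lideal_add)

lemma coset_add: "lideal I \<Longrightarrow> (a +o I) + (b +o I) = (a + b) +o I"
  for a b :: "'a::lattice_ab_group_add_abs"
  by (simp add: set_plus_rearrange lideal_plus_self)

text \<open>The case n = 0 has to be excluded: an empty sum of cosets is {0} and not the coset
  \<open>I\<close>.\<close>

lemma coset_nat_mult: "lideal I \<Longrightarrow> 0 < n \<Longrightarrow> nat_mult n (a +o I) = nat_mult n a +o I"
  for a :: "'a::lattice_ab_group_add_abs"
proof (induction n)
  case (Suc n)
  then show ?case
    by (cases "n = 0") (simp_all add: nat_mult_Suc coset_add)
qed simp

lemma coset_eq_self_iff: "lideal I \<Longrightarrow> a +o I = I \<longleftrightarrow> a \<in> I"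
  for a :: "'a::lattice_ab_group_add_abs"
  using coset_eq_iff[of I a 0] by simp

lemma quotient_le_coset_iff: "lideal I \<Longrightarrow> quotient_le (a +o I) (b +o I) \<longleftrightarrow> mod_le I a b"
  for a b :: "'a::lattice_ab_group_add_abs"
proof
  assume I: "lideal I" and "quotient_le (a +o I) (b +o I)"
  then obtain m n where mn: "m \<in> I" "n \<in> I" "a + m \<le> b + n"
    unfolding quotient_le_def elt_set_plus_def by auto
  then have "a \<le> b + (n - m)" by (simp add: algebra_simps)
  then show "mod_le I a b"
    unfolding mod_le_def using lideal_diff[OF I mn(2,1)] by blast
next
  assume I: "lideal I" and "mod_le I a b"
  then obtain m where "m \<in> I" "a \<le> b + m"
    unfolding mod_le_def by auto
  moreover have "a \<in> a +o I"
    using lideal_zero[OF I] set_plus_intro2[of 0 I a] by simp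
  ultimately show "quotient_le (a +o I) (b +o I)"
    unfolding quotient_le_def by blast
qed

lemma archimedean_quotient_iff:
  fixes I :: "'a::lattice_ab_group_add_abs set"
  assumes I: "lideal I"
  shows "archimedean_lgroup (quotient_carrier I) I quotient_le \<longleftrightarrow>
    (\<forall>a b. mod_le I 0 a \<and> (\<forall>n>0. mod_le I (nat_mult n a) b) \<longrightarrow> a \<in> I)"
proof -
  have all: "(\<forall>A\<in>quotient_carrier I. P A) \<longleftrightarrow> (\<forall>a. P (a +o I))" for P
    unfolding quotient_carrier_def by blast
  have "quotient_le I (a +o I) \<longleftrightarrow> mod_le I 0 a" for a
    using quotient_le_coset_iff[OF I, of 0 a] by simp
  moreover have "quotient_le (nat_mult n (a +o I)) (b +o I) \<longleftrightarrow> mod_le I (nat_mult n a) b"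
    if "0 < n" for a b n
    by (simp add: coset_nat_mult[OF I that] quotient_le_coset_iff[OF I])
  ultimately show ?thesis
    unfolding archimedean_lgroup_def all coset_eq_self_iff[OF I] by simp
qed

section \<open>Maximal ideals\<close>

lemma strong_unit_bound:
  assumes "strong_unit u"
  obtains n where "0 < n" "\<bar>x\<bar> \<le> nat_mult n u"
proof -
  have "0 \<le> u" "x \<in> principal_lideal u"
    using assms by (auto simp: strong_unit_def)
  then show ?thesis
    using that by (auto simp: principal_lideal_def)
qed

lemma lideal_eq_UNIV:
  assumes "strong_unit u" "lideal I" "u \<in> I"
  shows "I = UNIV"
  using principal_lideal_subset[OF assms(2,3)] assms(1) by (auto simp: strong_unit_def)

text \<open>Any two elements of the union already lie in one common member of the chain.\<close>

lemma lideal_Union_chain: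
  assumes "\<C> \<noteq> {}" "\<And>I. I \<in> \<C> \<Longrightarrow> lideal I" "\<And>I J. I \<in> \<C> \<Longrightarrow> J \<in> \<C> \<Longrightarrow> I \<subseteq> J \<or> J \<subseteq> I"
  shows "lideal (\<Union>\<C>)"
proof -
  have "\<exists>K\<in>\<C>. a \<in> K \<and> b \<in> K" if "a \<in> \<Union>\<C>" "b \<in> \<Union>\<C>" for a b
    using that assms(3) by blast
  moreover have "0 \<in> \<Union>\<C>"
    using assms(1,2) lideal_zero by blast
  ultimately show ?thesis
    unfolding lideal_def
    by (meson UnionI assms(2) lideal_convex lideal_diff lideal_sup lideal_def)
qed

lemma yosida_space_above:
  assumes "lideal I" "u \<notin> I"
  obtains M where "M \<in> yosida_space u" "I \<subseteq> M"
proof -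
  define \<A> where "\<A> = {N. lideal N \<and> u \<notin> N \<and> I \<subseteq> N}"
  have "\<exists>M\<in>\<A>. \<forall>X\<in>\<A>. M \<subseteq> X \<longrightarrow> X = M"
  proof (rule subset_Zorn_nonempty)
    show "\<A> \<noteq> {}" using assms by (auto simp: \<A>_def)
  next
    fix \<C> assume ne: "\<C> \<noteq> {}" and chain: "subset.chain \<A> \<C>"
    have sub: "\<C> \<subseteq> \<A>" and lin: "\<And>I J. I \<in> \<C> \<Longrightarrow> J \<in> \<C> \<Longrightarrow> I \<subseteq> J \<or> J \<subseteq> I"
      using chain by (auto simp: subset_chain_def)
    have "lideal (\<Union>\<C>)"
      using sub lin by (intro lideal_Union_chain ne) (auto simp: \<A>_def)
    then show "\<Union>\<C> \<in> \<A>"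
      using ne sub by (fastforce simp: \<A>_def)
  qed
  then obtain M where "M \<in> \<A>" and max: "\<And>X. X \<in> \<A> \<Longrightarrow> M \<subseteq> X \<Longrightarrow> X = M" by blast
  then have "M \<in> yosida_space u" "I \<subseteq> M"
    unfolding yosida_space_def \<A>_def by blast+
  then show ?thesis by (rule that)
qed

text \<open>The common denominator is the product of the two denominators. Numerators are split into
  differences of naturals because only natural multiples of group elements are available.\<close>

lemma rats_as_diff:
  fixes r s :: real
  assumes "r \<in> \<rat>" "s \<in> \<rat>"
  obtains p q n p' q' where "0 < n" "r * real n = real p - real q" "s * real n = real p' - real q'"
proof -
  have int: "real_of_int i = real (nat i) - real (nat (- i))" for i
    by (cases "0 \<le> i") auto
  obtain a b where ab: "b > 0" "r = of_int a / of_int b"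
    using assms(1) by (rule Rats_cases')
  obtain c d where cd: "d > 0" "s = of_int c / of_int d"
    using assms(2) by (rule Rats_cases')
  have n: "0 < nat (b * d)" "real (nat (b * d)) = of_int b * of_int d"
    using ab(1) cd(1) by simp_all
  have "r * real (nat (b * d)) = of_int (a * d)" "s * real (nat (b * d)) = of_int (c * b)"
    unfolding n using ab cd by simp_all
  with n(1) that show ?thesis
    unfolding int by blast
qed

lemma rat_as_diff:
  fixes r :: real
  assumes "r \<in> \<rat>"
  obtains p q n where "0 < n" "r * real n = real p - real q"
  by (rule rats_as_diff[OF assms assms]) (rule that)

section \<open>The quotient by one maximal ideal\<close>

locale yosida_point =
  fixes u :: "'a::lattice_ab_group_add_abs" and M :: "'a set"
  assumes strong: "strong_unit u" and point: "M \<in> yosida_space u"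
begin

lemma ideal: "lideal M"
  using point by (simp add: yosida_space_def)

lemma unit_notin: "u \<notin> M"
  using point by (simp add: yosida_space_def)

lemma unit_nonneg: "0 \<le> u"
  using strong by (simp add: strong_unit_def)

text \<open>The ideal \<open>N\<close> generated by \<open>M\<close> and \<open>a\<close> is
  strictly larger than \<open>M\<close>, so by maximality it contains \<open>u\<close>. The set
  \<open>B\<close> consists of the bounds that define \<open>N\<close>.\<close>

lemma unit_le_mod:
  assumes "0 \<le> a" "a \<notin> M"
  obtains m n where "m \<in> M" "0 \<le> m" "u \<le> m + nat_mult n a"
proof -
  define B where "B = {m + nat_mult n a |m n. m \<in> M \<and> 0 \<le> m}"
  define N where "N = {x. \<exists>b\<in>B. \<bar>x\<bar> \<le> b}"
  have "lideal N"
    unfolding N_def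
  proof (rule lideal_dominated[of 0])
    show "0 \<in> B"
      unfolding B_def using lideal_zero[OF ideal] by (auto intro!: exI[of _ 0])
  next
    fix b c assume "b \<in> B" "c \<in> B"
    then obtain m n m' n' where *: "b = m + nat_mult n a" "c = m' + nat_mult n' a"
      "m \<in> M" "0 \<le> m" "m' \<in> M" "0 \<le> m'"
      unfolding B_def by blast
    then have "b + c = (m + m') + nat_mult (n + n') a"
      by (simp add: nat_mult_distrib_right algebra_simps)
    moreover have "m + m' \<in> M" "0 \<le> m + m'"
      using * by (simp_all add: lideal_add ideal)
    ultimately show "\<exists>d\<in>B. b + c \<le> d"
      unfolding B_def by blast
  qed simp
  moreover have "M \<subseteq> N"
  proof
    fix x assume "x \<in> M"
    then have "\<bar>x\<bar> + nat_mult 0 a \<in> B"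
      unfolding B_def using lideal_abs[OF ideal] abs_ge_zero by blast
    then show "x \<in> N"
      unfolding N_def by auto
  qed
  moreover have "a \<in> N"
  proof -
    have "0 + nat_mult (Suc 0) a \<in> B"
      unfolding B_def using lideal_zero[OF ideal] by blast
    then show ?thesis
      unfolding N_def using assms(1) by auto
  qed
  ultimately have "u \<in> N"
    using point assms(2) unfolding yosida_space_def by blast
  then show ?thesis
    using that abs_ge_self[of u] order_trans unfolding N_def B_def by blast
qed

text \<open>If both were outside \<open>M\<close>, then \<open>u\<close> would lie below
  \<open>m + m'\<close> plus multiples of \<open>a\<close> and of \<open>b\<close>. These multiples
  are disjoint, so the infimum of the two bounds is \<open>m + m'\<close>, which puts
  \<open>u\<close> into \<open>M\<close>.\<close>

lemma prime:
  assumes "0 \<le> a" "0 \<le> b" "inf a b = 0"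
  shows "a \<in> M \<or> b \<in> M"
proof (rule ccontr)
  assume "\<not> ?thesis"
  then have "a \<notin> M" "b \<notin> M" by auto
  obtain m n where m: "m \<in> M" "0 \<le> m" "u \<le> m + nat_mult n a"
    using unit_le_mod[OF assms(1) \<open>a \<notin> M\<close>] .
  obtain m' n' where m': "m' \<in> M" "0 \<le> m'" "u \<le> m' + nat_mult n' b"
    using unit_le_mod[OF assms(2) \<open>b \<notin> M\<close>] .
  have "u \<le> (m + m') + nat_mult n a" "u \<le> (m + m') + nat_mult n' b"
    using m(3) m'(3) add_increasing[OF m(2) m'(3)] add_increasing[OF m'(2) m(3)]
    by (simp_all add: algebra_simps)
  then have "u \<le> inf ((m + m') + nat_mult n a) ((m + m') + nat_mult n' b)"
    by simp
  also have "\<dots> = m + m'"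
    by (simp add: inf_nat_mult2_eq_0[OF assms] flip: add_inf_distrib_left)
  finally have "u \<in> M"
    using lideal_nonneg_le[OF ideal unit_nonneg] lideal_add[OF ideal m(1) m'(1)] by blast
  then show False using unit_notin by blast
qed

lemma inf_abs_in_iff: "inf \<bar>f\<bar> \<bar>g\<bar> \<in> M \<longleftrightarrow> f \<in> M \<or> g \<in> M"
proof
  assume *: "inf \<bar>f\<bar> \<bar>g\<bar> \<in> M"
  let ?d = "inf \<bar>f\<bar> \<bar>g\<bar>"
  \<comment> \<open>Subtracting the infimum from both elements makes them disjoint, so that
    \<open>prime\<close> applies; adding back \<open>?d\<close>, which is in \<open>M\<close>,
    changes nothing modulo \<open>M\<close>.\<close>
  have "inf (\<bar>f\<bar> - ?d) (\<bar>g\<bar> - ?d) = 0"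
    using add_inf_distrib_right[of "\<bar>f\<bar>" "\<bar>g\<bar>" "- ?d"]
    by (simp del: neg_inf_eq_sup diff_inf_eq_sup)
  then have "\<bar>f\<bar> - ?d \<in> M \<or> \<bar>g\<bar> - ?d \<in> M"
    using prime[of "\<bar>f\<bar> - ?d" "\<bar>g\<bar> - ?d"] by (simp del: neg_inf_eq_sup diff_inf_eq_sup)
  then have "\<bar>f\<bar> \<in> M \<or> \<bar>g\<bar> \<in> M"
    using lideal_add[OF ideal _ *] by (metis diff_add_cancel)
  then show "f \<in> M \<or> g \<in> M"
    using lideal_abs_iff[OF ideal] by blast
next
  assume "f \<in> M \<or> g \<in> M"
  then have "\<bar>f\<bar> \<in> M \<or> \<bar>g\<bar> \<in> M"
    using lideal_abs_iff[OF ideal] by blast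
  then show "inf \<bar>f\<bar> \<bar>g\<bar> \<in> M"
    using lideal_nonneg_le[OF ideal, of "inf \<bar>f\<bar> \<bar>g\<bar>"]
    by (metis abs_ge_zero inf.cobounded1 inf.cobounded2 le_inf_iff)
qed

section \<open>The total order modulo \<open>M\<close>\<close>

abbreviation le_mod :: "'a \<Rightarrow> 'a \<Rightarrow> bool" (infix "\<sqsubseteq>" 50) where
  "a \<sqsubseteq> b \<equiv> mod_le M a b"

lemmas mod_trans = mod_le_trans[OF ideal]
  and mod_add = mod_le_add[OF ideal]
  and mod_le = mod_le_if_le[OF ideal]
  and mod_nat_mult = mod_le_nat_mult[OF ideal]

lemma mod_total: "a \<sqsubseteq> b \<or> b \<sqsubseteq> a"
proof -
  have "pprt (a - b) \<in> M \<or> pprt (- (a - b)) \<in> M"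
    by (rule prime) (simp_all add: inf_pprt_pprt_uminus del: minus_diff_eq)
  then show ?thesis
    by (simp add: mod_le_iff_pprt[OF ideal])
qed

lemma mod_nonneg_nat_mult:
  assumes "0 \<sqsubseteq> x" "0 < n"
  shows "x \<sqsubseteq> nat_mult n x"
proof -
  obtain k where n: "n = Suc k"
    using assms(2) gr0_implies_Suc by blast
  have "0 \<sqsubseteq> nat_mult k x"
    using mod_nat_mult[OF assms(1), of k] by simp
  from mod_add[OF this mod_le[OF order_refl, of x]] show ?thesis
    by (simp add: n nat_mult_Suc)
qed

lemma mod_nat_mult_cancel:
  assumes "nat_mult n a \<sqsubseteq> nat_mult n b" "0 < n"
  shows "a \<sqsubseteq> b"
proof -
  have "nat_mult n a = nat_mult n (a - b) + nat_mult n b"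
    by (simp flip: nat_mult_distrib_left)
  then have le0: "nat_mult n (a - b) \<sqsubseteq> 0"
    using assms(1) mod_le_add_right_cancel[of M "nat_mult n (a - b)" "nat_mult n b" 0] by simp
  \<comment> \<open>By totality only the case that \<open>a - b\<close> is nonnegative modulo
    \<open>M\<close> remains, and there it lies below its own n-th multiple, which is at most
    0.\<close>
  have "a - b \<sqsubseteq> 0"
    using mod_total[of "a - b" 0] mod_trans[OF mod_nonneg_nat_mult[OF _ assms(2)] le0] by blast
  then show ?thesis by (simp add: mod_le_diff_iff)
qed

lemma not_unit_le_zero: "\<not> u \<sqsubseteq> 0"
  using mod_le_zero_iff_pprt[OF ideal, of u] unit_notin unit_nonneg by simp

lemma mod_nat_mult_unit_iff: "nat_mult m u \<sqsubseteq> nat_mult n u \<longleftrightarrow> m \<le> n"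
proof
  show "nat_mult m u \<sqsubseteq> nat_mult n u" if "m \<le> n"
    by (rule mod_le) (rule nat_mult_mono_left[OF that unit_nonneg])
next
  assume *: "nat_mult m u \<sqsubseteq> nat_mult n u"
  show "m \<le> n"
  proof (rule ccontr)
    assume "\<not> m \<le> n"
    then have "nat_mult (Suc n) u \<sqsubseteq> nat_mult m u"
      by (intro mod_le nat_mult_mono_left unit_nonneg) simp
    from mod_trans[OF this *] have "u + nat_mult n u \<sqsubseteq> 0 + nat_mult n u"
      by (simp add: nat_mult_Suc add.commute)
    then show False
      using not_unit_le_zero by (simp only: mod_le_add_right_cancel)
  qed
qed

text \<open>The rational \<open>r = (p - q) / n\<close> satisfies \<open>r u \<le> g\<close> modulo \<open>M\<close>; negative multiples of \<open>u\<close>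
  are moved to the other side.\<close>

definition below :: "real \<Rightarrow> 'a \<Rightarrow> bool" where
  "below r g \<longleftrightarrow> (\<exists>p q n. 0 < n \<and> r * real n = real p - real q
     \<and> nat_mult p u \<sqsubseteq> nat_mult n g + nat_mult q u)"

lemma belowE:
  assumes "below r g"
  obtains p q n where "0 < n" "r * real n = real p - real q"
    "nat_mult p u \<sqsubseteq> nat_mult n g + nat_mult q u"
  using assms unfolding below_def by blast

text \<open>The Hoelder cut: \<open>below\<close> holds of rationals only, and the supremum of those
  r with r u \<le> g modulo \<open>M\<close> will turn out to be g(M).\<close>

definition val :: "'a \<Rightarrow> real" where
  "val g = Sup {r. below r g}"

text \<open>Cross-multiply the two fractions, cancel the common multiple of \<open>u\<close> and
  divide by \<open>n'\<close>. As the representation of \<open>s\<close> is arbitrary, this gives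
  both downward closure and, for \<open>s = r\<close>, independence of the chosen fraction.\<close>

lemma below_mono:
  assumes "below r g" "s \<le> r" "0 < n" "s * real n = real p - real q"
  shows "nat_mult p u \<sqsubseteq> nat_mult n g + nat_mult q u"
proof -
  obtain p' q' n' where n': "0 < n'" and r: "r * real n' = real p' - real q'"
    and le: "nat_mult p' u \<sqsubseteq> nat_mult n' g + nat_mult q' u"
    using assms(1) by (rule belowE)
  have "(s * real n) * real n' \<le> (r * real n') * real n"
    using assms(2,3) n' by (simp add: mult.assoc mult.commute mult.left_commute mult_right_mono)
  then have "(real p - real q) * real n' \<le> (real p' - real q') * real n"
    by (simp only: assms(4) r)
  then have "real (p * n' + q' * n) \<le> real (p' * n + q * n')"
    by (simp add: algebra_simps)
  then have nat_le: "p * n' + q' * n \<le> p' * n + q * n'"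
    by (simp only: of_nat_le_iff)
  have "nat_mult (n' * p) u + nat_mult (n * q') u \<le> nat_mult (n * p') u + nat_mult (n' * q) u"
    using nat_mult_mono_left[OF nat_le unit_nonneg]
    by (simp add: nat_mult_distrib_right mult.commute)
  moreover have "nat_mult (n * p') u + nat_mult (n' * q) u \<sqsubseteq>
      (nat_mult n (nat_mult n' g) + nat_mult (n * q') u) + nat_mult (n' * q) u"
    using mod_nat_mult[OF le, of n]
    by (simp add: mod_le_add_right_cancel nat_mult_mult nat_mult_distrib_left)
  ultimately have "nat_mult (n' * p) u + nat_mult (n * q') u \<sqsubseteq>
      (nat_mult n (nat_mult n' g) + nat_mult (n' * q) u) + nat_mult (n * q') u"
    using mod_trans mod_le by (simp add: add_ac) blast
  then have "nat_mult n' (nat_mult p u) \<sqsubseteq> nat_mult n' (nat_mult n g + nat_mult q u)"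
    unfolding mod_le_add_right_cancel
    by (simp add: nat_mult_mult nat_mult_distrib_left nat_mult_swap[of n n'])
  then show ?thesis
    using mod_nat_mult_cancel n' by blast
qed

lemma below_iff:
  assumes "0 < n" "r * real n = real p - real q"
  shows "below r g \<longleftrightarrow> nat_mult p u \<sqsubseteq> nat_mult n g + nat_mult q u"
proof
  show "nat_mult p u \<sqsubseteq> nat_mult n g + nat_mult q u" if "below r g"
    by (rule below_mono[OF that order_refl assms])
qed (unfold below_def, use assms in blast)

lemma below_le: "below r g \<Longrightarrow> s \<in> \<rat> \<Longrightarrow> s \<le> r \<Longrightarrow> below s g"
proof -
  assume r: "below r g" "s \<le> r" and "s \<in> \<rat>"
  obtain p q n where n: "0 < n" "s * real n = real p - real q"
    using rat_as_diff[OF \<open>s \<in> \<rat>\<close>] .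
  with below_mono[OF r n] show ?thesis
    unfolding below_def by blast
qed

text \<open>Over a common denominator the first claim adds two inequalities. The second uses
  totality: failure of \<open>below s g\<close> is the reverse inequality, which can be substituted
  and cancelled. The two claims yield the two halves of additivity of \<open>val\<close>.\<close>

lemma below_add:
  assumes "r \<in> \<rat>" "s \<in> \<rat>"
  shows "below r f \<Longrightarrow> below s g \<Longrightarrow> below (r + s) (f + g)"
    and "\<not> below r f \<Longrightarrow> \<not> below s g \<Longrightarrow> \<not> below (r + s) (f + g)"
proof -
  obtain p q n p' q' where n: "0 < n" and r: "r * real n = real p - real q"
    and s: "s * real n = real p' - real q'"
    using rats_as_diff[OF assms] .
  have rs: "(r + s) * real n = real (p + p') - real (q + q')"
    using r s by (simp add: algebra_simps)
  note iffs = below_iff[OF n r] below_iff[OF n s] below_iff[OF n rs]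
  have sum: "nat_mult n (f + g) + nat_mult (q + q') u =
      (nat_mult n f + nat_mult q u) + (nat_mult n g + nat_mult q' u)"
    by (simp add: nat_mult_distrib_left nat_mult_distrib_right algebra_simps)
  show "below (r + s) (f + g)" if "below r f" "below s g"
    using that mod_add unfolding iffs sum by (simp add: nat_mult_distrib_right)
  show "\<not> below (r + s) (f + g)" if "\<not> below r f" "\<not> below s g"
  proof
    assume "below (r + s) (f + g)"
    then have 1: "nat_mult p u + nat_mult p' u \<sqsubseteq>
        (nat_mult n f + nat_mult q u) + (nat_mult n g + nat_mult q' u)"
      unfolding iffs sum by (simp add: nat_mult_distrib_right)
    have "nat_mult n g + nat_mult q' u \<sqsubseteq> nat_mult p' u"
      using that(2) mod_total unfolding iffs by blast
    from mod_trans[OF 1 mod_add[OF mod_le[OF order_refl] this]]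
    show False
      using that(1) unfolding iffs by (simp only: mod_le_add_right_cancel)
  qed
qed

text \<open>A multiple of the strong unit above \<bar>g\<bar> bounds the cut and also shows that it
  is nonempty, so that the supremum is meaningful.\<close>

lemma below_bounds:
  obtains k :: nat where "below (- real k) g" "\<And>r. below r g \<Longrightarrow> r \<le> real k"
proof -
  obtain k where k: "\<bar>g\<bar> \<le> nat_mult k u"
    using strong_unit_bound[OF strong] .
  have "- g \<le> nat_mult k u" "g \<le> nat_mult k u"
    using k order_trans[OF abs_ge_minus_self k] order_trans[OF abs_ge_self k] by auto
  then have "0 \<le> g + nat_mult k u"
    using add_left_mono[of "- g" "nat_mult k u" g] by simp
  then have "below (- real k) g"
    using below_iff[of 1 "- real k" 0 k g] mod_le by simp
  moreover have "r \<le> real k" if r_below: "below r g" for r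
  proof -
    obtain p q n where n: "0 < n" and r: "r * real n = real p - real q"
      and le: "nat_mult p u \<sqsubseteq> nat_mult n g + nat_mult q u"
      using r_below by (rule belowE)
    have "nat_mult n g + nat_mult q u \<le> nat_mult (n * k + q) u"
      using nat_mult_mono[OF \<open>g \<le> nat_mult k u\<close>, of n]
      by (simp add: nat_mult_distrib_right nat_mult_mult)
    then have "p \<le> n * k + q"
      using mod_trans[OF le mod_le, of "nat_mult (n * k + q) u"] by (simp only: mod_nat_mult_unit_iff)
    then have "real p \<le> real (n * k + q)"
      by (simp only: of_nat_le_iff)
    then have "r * real n \<le> real k * real n"
      using r by (simp add: mult.commute)
    then show ?thesis using n by simp
  qed
  ultimately show ?thesis by (rule that)
qed

lemma below_nonempty: "{r. below r g} \<noteq> {}"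
  by (rule below_bounds[of g]) blast

lemma below_bdd_above: "bdd_above {r. below r g}"
  by (rule below_bounds[of g]) (auto simp: bdd_above_def)

lemma below_imp_le_val: "below r g \<Longrightarrow> r \<le> val g"
  unfolding val_def by (rule cSup_upper) (simp_all add: below_bdd_above)

lemma less_val_imp_below:
  assumes "r \<in> \<rat>" "r < val g"
  shows "below r g"
proof -
  obtain s where "below s g" "r < s"
    using less_cSupE[OF assms(2)[unfolded val_def] below_nonempty] by blast
  then show ?thesis
    using below_le assms(1) by simp
qed

lemma val_mono: "f \<sqsubseteq> g \<Longrightarrow> val f \<le> val g"
proof -
  assume fg: "f \<sqsubseteq> g"
  have "below r g" if r_below: "below r f" for r
  proof -
    obtain p q n where n: "0 < n" "r * real n = real p - real q"
      and le: "nat_mult p u \<sqsubseteq> nat_mult n f + nat_mult q u"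
      using r_below by (rule belowE)
    have "nat_mult n f + nat_mult q u \<sqsubseteq> nat_mult n g + nat_mult q u"
      by (simp add: mod_le_add_right_cancel mod_nat_mult fg)
    from mod_trans[OF le this] show ?thesis
      using below_iff[OF n] by blast
  qed
  moreover note below_nonempty[of f]
  ultimately show ?thesis
    unfolding val_def[of f] by (intro cSup_least) (auto intro: below_imp_le_val)
qed

lemma val_add: "val (f + g) = val f + val g"
proof (rule antisym)
  show "val f + val g \<le> val (f + g)"
  proof (rule ccontr)
    \<comment> \<open>Half of the supposed gap: rationals within \<open>e\<close> below
      \<open>val f\<close> and \<open>val g\<close> have a sum that still exceeds
      \<open>val (f + g)\<close>. The other half of the proof is the mirror image from
      above.\<close>
    define e where "e = (val f + val g - val (f + g)) / 2"
    assume "\<not> ?thesis"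
    then have "val f - e < val f" "val g - e < val g" by (simp_all add: e_def)
    then obtain r s where rs: "r \<in> \<rat>" "val f - e < r" "r < val f" "s \<in> \<rat>" "val g - e < s" "s < val g"
      using Rats_dense_in_real by meson
    then have "r + s \<le> val (f + g)"
      by (intro below_imp_le_val below_add less_val_imp_below)
    then show False using rs by (simp add: e_def field_simps)
  qed
  show "val (f + g) \<le> val f + val g"
  proof (rule ccontr)
    define e where "e = (val (f + g) - val f - val g) / 2"
    assume "\<not> ?thesis"
    then have "val f < val f + e" "val g < val g + e" by (simp_all add: e_def)
    then obtain r s where rs: "r \<in> \<rat>" "val f < r" "r < val f + e" "s \<in> \<rat>" "val g < s" "s < val g + e"
      using Rats_dense_in_real by meson
    then have "\<not> below r f" "\<not> below s g"
      using below_imp_le_val by fastforce+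
    then have "\<not> below (r + s) (f + g)"
      by (rule below_add(2)[OF rs(1,4)])
    then have "val (f + g) \<le> r + s"
      using less_val_imp_below[of "r + s" "f + g"] rs(1,4) by fastforce
    then show False using rs by (simp add: e_def field_simps)
  qed
qed

lemma val_0: "val 0 = 0"
  using val_add[of 0 0] by simp

lemma val_diff: "val (f - g) = val f - val g"
  using val_add[of "f - g" g] by simp

text \<open>By primeness \<bar>g\<bar> is bounded by \<open>g\<close> or by \<open>- g\<close>
  modulo \<open>M\<close>, so its value is at most 0 if that of \<open>g\<close> is 0. If
  \<open>g\<close> were outside \<open>M\<close>, then u \<le> n \<bar>g\<bar> modulo
  \<open>M\<close> would force a value of at least 1/n.\<close>

lemma val_eq_0_iff: "val g = 0 \<longleftrightarrow> g \<in> M"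
proof
  assume "g \<in> M"
  then have "g \<sqsubseteq> 0" "0 \<sqsubseteq> g"
    unfolding mod_le_def using lideal_uminus[OF ideal] by force+
  then show "val g = 0"
    using val_mono val_0 by (metis order_antisym)
next
  assume g0: "val g = 0"
  have abs: "\<bar>g\<bar> \<sqsubseteq> g \<or> \<bar>g\<bar> \<sqsubseteq> - g"
  proof -
    have "pprt g \<in> M \<or> pprt (- g) \<in> M"
      by (rule prime) (simp_all add: inf_pprt_pprt_uminus)
    moreover have "\<bar>g\<bar> = g + (pprt (- g) + pprt (- g))" "\<bar>g\<bar> = - g + (pprt g + pprt g)"
      using prts[of g] by (simp_all add: abs_prts pprt_neg algebra_simps)
    ultimately show ?thesis
      unfolding mod_le_def using lideal_add[OF ideal] by (metis order_refl)
  qed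
  then have "val \<bar>g\<bar> \<le> 0"
    using val_mono[of "\<bar>g\<bar>" g] val_mono[of "\<bar>g\<bar>" "- g"] val_diff[of 0 g] g0 val_0 by auto
  show "g \<in> M"
  proof (rule ccontr)
    assume "g \<notin> M"
    then have "\<bar>g\<bar> \<notin> M"
      using lideal_abs_iff[OF ideal] by blast
    then obtain m n where m: "m \<in> M" "u \<le> m + nat_mult n \<bar>g\<bar>"
      using unit_le_mod[OF abs_ge_zero] by metis
    then have le: "u \<sqsubseteq> nat_mult n \<bar>g\<bar>"
      unfolding mod_le_def by (auto simp: add.commute)
    then have "0 < n"
      using not_unit_le_zero by (cases n) auto
    then have "below (1 / real n) \<bar>g\<bar>"
      using below_iff[of n "1 / real n" 1 0 "\<bar>g\<bar>"] le by simp
    then have "1 / real n \<le> val \<bar>g\<bar>"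
      by (rule below_imp_le_val)
    then have "1 / real n \<le> 0"
      using \<open>val \<bar>g\<bar> \<le> 0\<close> by linarith
    then show False using \<open>0 < n\<close> by simp
  qed
qed

lemma val_eq_iff: "val f = val g \<longleftrightarrow> f - g \<in> M"
  using val_eq_0_iff[of "f - g"] by (simp add: val_diff)

lemma val_unit: "val u = 1"
proof (rule antisym)
  show "1 \<le> val u"
    by (rule below_imp_le_val) (use below_iff[of 1 1 1 0 u] mod_le in simp)
  have "r \<le> 1" if r_below: "below r u" for r
  proof -
    obtain p q n where n: "0 < n" "r * real n = real p - real q"
      and "nat_mult p u \<sqsubseteq> nat_mult n u + nat_mult q u"
      using r_below by (rule belowE)
    then have "p \<le> n + q"
      by (simp add: mod_nat_mult_unit_iff flip: nat_mult_distrib_right)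
    then have "r * real n \<le> 1 * real n"
      using n by simp
    then show ?thesis using n(1) by simp
  qed
  moreover note below_nonempty[of u]
  ultimately show "val u \<le> 1"
    unfolding val_def by (intro cSup_least) auto
qed

lemma val_sup: "val (sup f g) = sup (val f) (val g)"
proof -
  have *: "val (sup f g) = val g" if "f \<sqsubseteq> g" for f g
  proof -
    \<comment> \<open>This positive part lies in \<open>M\<close> when f \<le> g modulo
      \<open>M\<close>, so the supremum and \<open>g\<close> have the same coset.\<close>
    have "sup f g - g = pprt (f - g)"
      using add_sup_distrib_right[of f g "- g"] by (simp add: pprt_def del: diff_sup_eq_inf)
    then have "sup f g - g \<in> M"
      using that mod_le_iff_pprt[OF ideal] by simp
    then show ?thesis
      by (simp add: val_eq_iff)
  qed
  then show ?thesis
    using mod_total[of f g] *[of f g] *[of g f] val_mono[of f g] val_mono[of g f]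
    by (auto simp: sup_commute[of f g] sup_absorb1 sup_absorb2)
qed

lemma val_inf: "val (inf f g) = inf (val f) (val g)"
proof -
  have "val (inf f g) = val (f + g) - val (sup f g)"
    by (simp add: add_eq_inf_sup[of f g] val_add)
  then show ?thesis
    by (simp add: val_sup val_add sup_real_def inf_real_def max_def min_def)
qed

section \<open>Existence and uniqueness of the Yosida embedding\<close>

lemma embedding_exists: "\<exists>\<phi>. yosida_embedding u M \<phi>"
proof
  \<comment> \<open>An embedding takes cosets as arguments, so a representative is chosen;
    \<open>val\<close> is constant on cosets, which makes the choice harmless.\<close>
  define \<phi> where "\<phi> X = val (SOME x. x \<in> X)" for X
  have eq: "\<phi> (g +o M) = val g" for g
  proof -
    have "g \<in> g +o M"
      using lideal_zero[OF ideal] set_plus_intro2[of 0 M g] by simp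
    then have "(SOME x. x \<in> g +o M) \<in> g +o M"
      by (rule someI)
    then show ?thesis
      by (simp add: \<phi>_def val_eq_iff set_minus_plus)
  qed
  have "inj_on \<phi> (quotient_carrier M)"
  proof (rule inj_onI)
    fix X Y assume "X \<in> quotient_carrier M" "Y \<in> quotient_carrier M" and XY: "\<phi> X = \<phi> Y"
    then obtain f g where "X = f +o M" "Y = g +o M"
      unfolding quotient_carrier_def by blast
    then show "X = Y"
      using XY by (simp add: eq val_eq_iff coset_eq_iff[OF ideal])
  qed
  then show "yosida_embedding u M \<phi>"
    unfolding yosida_embedding_def
    by (simp only: eq coset_add[OF ideal] val_add val_sup val_inf val_unit simp_thms)
qed

lemma embedding_coset:
  assumes "yosida_embedding u M \<phi>"
  shows "\<phi> ((f + g) +o M) = \<phi> (f +o M) + \<phi> (g +o M)"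
    and "\<phi> (sup f g +o M) = sup (\<phi> (f +o M)) (\<phi> (g +o M))"
    and "\<phi> (u +o M) = 1"
    and "\<phi> (g +o M) = 0 \<longleftrightarrow> g \<in> M"
proof -
  show add: "\<phi> ((f + g) +o M) = \<phi> (f +o M) + \<phi> (g +o M)" for f g
    using assms unfolding yosida_embedding_def by (simp add: coset_add[OF ideal])
  show "\<phi> (sup f g +o M) = sup (\<phi> (f +o M)) (\<phi> (g +o M))" "\<phi> (u +o M) = 1"
    using assms unfolding yosida_embedding_def by simp_all
  have "\<phi> (0 +o M) = 0"
    using add[of 0 0] by simp
  then have "\<phi> (g +o M) = 0 \<longleftrightarrow> \<phi> (g +o M) = \<phi> (0 +o M)"
    by simp
  also have "\<dots> \<longleftrightarrow> g +o M = 0 +o M"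
  proof (rule inj_on_eq_iff)
    show "inj_on \<phi> (quotient_carrier M)"
      using assms by (simp add: yosida_embedding_def)
  qed (unfold quotient_carrier_def, blast+)
  also have "\<dots> \<longleftrightarrow> g \<in> M"
    by (simp only: coset_eq_iff[OF ideal] diff_zero)
  finally show "\<phi> (g +o M) = 0 \<longleftrightarrow> g \<in> M" .
qed

text \<open>Stated as an inequality, since exchanging the two embeddings gives uniqueness. A
  rational strictly between two different values yields an element \<open>x\<close> that is negative
  under one embedding and positive under the other; then \<open>sup x 0\<close> is in the kernel of
  only one, although both kernels are \<open>M\<close>.\<close>

lemma embedding_le:
  assumes \<phi>: "yosida_embedding u M \<phi>" and \<psi>: "yosida_embedding u M \<psi>"
  shows "\<psi> (g +o M) \<le> \<phi> (g +o M)"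
proof (rule ccontr)
  assume "\<not> ?thesis"
  then obtain r where r: "r \<in> \<rat>" "\<phi> (g +o M) < r" "r < \<psi> (g +o M)"
    using Rats_dense_in_real by (meson not_le)
  obtain p q n where n: "0 < n" "r * real n = real p - real q"
    using rat_as_diff[OF r(1)] .
  \<comment> \<open>This is n (g - r u), with the integer n r split into \<open>p\<close> and
    \<open>q\<close>.\<close>
  define x where "x = nat_mult n g + nat_mult q u - nat_mult p u"
  have x: "\<theta> (x +o M) = real n * (\<theta> (g +o M) - r)" if \<theta>: "yosida_embedding u M \<theta>" for \<theta>
  proof -
    note add = embedding_coset(1)[OF \<theta>]
    have mult: "\<theta> (nat_mult k y +o M) = real k * \<theta> (y +o M)" for k y
      using embedding_coset(4)[OF \<theta>, of 0] lideal_zero[OF ideal]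
      by (induction k) (simp_all add: nat_mult_Suc add algebra_simps)
    have "\<theta> (x +o M) + real p = real n * \<theta> (g +o M) + real q"
      using add[of x "nat_mult p u"] add[of "nat_mult n g" "nat_mult q u"] embedding_coset(3)[OF \<theta>]
      by (simp add: x_def mult)
    then show ?thesis using n(2) by (simp add: algebra_simps)
  qed
  have "\<phi> (x +o M) < 0" "0 < \<psi> (x +o M)"
    unfolding x[OF \<phi>] x[OF \<psi>] using n(1) r by (simp_all add: mult_pos_neg)
  moreover have "\<phi> (0 +o M) = 0" "\<psi> (0 +o M) = 0"
    using embedding_coset(4)[OF \<phi>, of 0] embedding_coset(4)[OF \<psi>, of 0] lideal_zero[OF ideal] by simp_all
  ultimately have "\<phi> (sup x 0 +o M) = 0" "\<psi> (sup x 0 +o M) \<noteq> 0"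
    unfolding embedding_coset(2)[OF \<phi>] embedding_coset(2)[OF \<psi>] by (simp_all add: sup_real_def)
  then show False
    using embedding_coset(4)[OF \<phi>, of "sup x 0"] embedding_coset(4)[OF \<psi>, of "sup x 0"] by simp
qed

lemma yosida_value_eq_0_iff: "yosida_value u g M = 0 \<longleftrightarrow> g \<in> M"
proof -
  obtain \<phi> where \<phi>: "yosida_embedding u M \<phi>"
    using embedding_exists by blast
  have "yosida_value u g M = \<phi> (g +o M)"
    unfolding yosida_value_def
  proof (rule the_equality)
    fix r assume "\<exists>\<psi>. yosida_embedding u M \<psi> \<and> r = \<psi> (g +o M)"
    then show "r = \<phi> (g +o M)"
      using embedding_le[OF \<phi>] embedding_le[OF _ \<phi>] by (blast intro: antisym)
  qed (use \<phi> in blast)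
  then show ?thesis using embedding_coset(4)[OF \<phi>] by simp
qed

end

section \<open>Cozero sets and the hull-kernel topology\<close>

lemma coz_eq: "strong_unit u \<Longrightarrow> coz u g = {M \<in> yosida_space u. g \<notin> M}"
  unfolding coz_def using yosida_point.yosida_value_eq_0_iff[OF yosida_point.intro] by blast

text \<open>The Archimedean property gives n with n \<bar>f\<bar> not below \<open>u\<close>, so
  \<open>pprt x\<close> is nonzero. It is disjoint from \<open>pprt (- x)\<close>, hence the ideal
  generated by the latter is proper and lies in some point \<open>M\<close>. If \<open>f\<close>
  were in \<open>M\<close>, so would be n \<bar>f\<bar> + \<open>pprt (- x)\<close>, which is above
  \<open>u\<close>.\<close>

lemma yosida_separates:
  fixes f u :: "'a::lattice_ab_group_add_abs"
  assumes arch: "archimedean_lgroup (UNIV :: 'a set) 0 (\<le>)" and u: "strong_unit u" and "f \<noteq> 0"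
  obtains M where "M \<in> yosida_space u" "f \<notin> M"
proof -
  have "\<bar>f\<bar> \<noteq> 0" using \<open>f \<noteq> 0\<close> by simp
  then obtain n where n: "\<not> nat_mult n \<bar>f\<bar> \<le> u"
    using arch abs_ge_zero[of f] unfolding archimedean_lgroup_def by blast
  define x where "x = nat_mult n \<bar>f\<bar> - u"
  have "pprt x \<noteq> 0"
    using n le_zero_iff_zero_pprt[of x] by (simp add: x_def)
  have "u \<notin> principal_lideal (pprt (- x))"
  proof
    assume "u \<in> principal_lideal (pprt (- x))"
    then have "pprt x \<in> principal_lideal (pprt (- x))"
      using lideal_eq_UNIV[OF u lideal_principal] by blast
    then obtain k where "pprt x \<le> nat_mult k (pprt (- x))"
      unfolding principal_lideal_def by auto
    then have "pprt x = inf (pprt x) (nat_mult k (pprt (- x)))"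
      by (simp add: inf_absorb1)
    also have "\<dots> = 0"
      by (simp add: inf_nat_mult_eq_0 inf_pprt_pprt_uminus)
    finally show False using \<open>pprt x \<noteq> 0\<close> by simp
  qed
  then obtain M where M: "M \<in> yosida_space u" "principal_lideal (pprt (- x)) \<subseteq> M"
    using yosida_space_above[OF lideal_principal] by metis
  interpret yosida_point u M
    using u M(1) by (rule yosida_point.intro)
  have "f \<notin> M"
  proof
    assume "f \<in> M"
    then have "nat_mult n \<bar>f\<bar> + pprt (- x) \<in> M"
      using M(2) principal_lideal_self by (intro lideal_add lideal_nat_mult lideal_abs ideal) auto
    moreover have "u \<le> nat_mult n \<bar>f\<bar> + pprt (- x)"
      using add_left_mono[OF le_pprt[of "- x"], of "nat_mult n \<bar>f\<bar>"] by (simp add: x_def)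
    ultimately show False
      using lideal_nonneg_le[OF ideal unit_nonneg] unit_notin by blast
  qed
  then show ?thesis using that M(1) by blast
qed

lemma coz_inf_abs: "strong_unit u \<Longrightarrow> coz u (inf \<bar>f\<bar> \<bar>g\<bar>) = coz u f \<inter> coz u g"
  using yosida_point.inf_abs_in_iff[OF yosida_point.intro] by (auto simp: coz_eq)

text \<open>Separation says that only 0 has an empty cozero set; apply this to the infimum, whose
  cozero set is the intersection.\<close>

lemma inf_abs_eq_0_iff_coz:
  fixes f g u :: "'a::lattice_ab_group_add_abs"
  assumes "archimedean_lgroup (UNIV :: 'a set) 0 (\<le>)" "strong_unit u"
  shows "inf \<bar>f\<bar> \<bar>g\<bar> = 0 \<longleftrightarrow> coz u f \<inter> coz u g = {}"
proof -
  have "x = 0 \<longleftrightarrow> coz u x = {}" for x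
  proof
    show "coz u x = {}" if "x = 0"
      using that by (auto simp: coz_eq[OF assms(2)] yosida_space_def lideal_zero)
    show "x = 0" if "coz u x = {}"
      using that yosida_separates[OF assms, of x] by (auto simp: coz_eq[OF assms(2)])
  qed
  then show ?thesis by (simp add: coz_inf_abs[OF assms(2)])
qed

lemma openin_coz: "strong_unit u \<Longrightarrow> openin (hull_kernel_topology u) (coz u h)"
  unfolding hull_kernel_topology_def by (rule topology_generated_by_Basis) (auto simp: coz_eq)

text \<open>The topology is generated by the cozero sets as a subbase. They are closed under binary
  intersection by \<open>coz_inf_abs\<close>, so they form a base.\<close>

lemma coz_base:
  assumes u: "strong_unit u" and "openin (hull_kernel_topology u) T" "M \<in> T"
  shows "\<exists>h. M \<in> coz u h \<and> coz u h \<subseteq> T"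
proof -
  have "generate_topology_on {{M \<in> yosida_space u. g \<notin> M} |g. True} T"
    using assms(2) unfolding hull_kernel_topology_def by (rule openin_topology_generated_by)
  then show ?thesis
    using \<open>M \<in> T\<close>
  proof (induction T)
    case (Int S T)
    then obtain h k where "M \<in> coz u h" "coz u h \<subseteq> S" "M \<in> coz u k" "coz u k \<subseteq> T" by blast
    then show ?case
      by (intro exI[of _ "inf \<bar>h\<bar> \<bar>k\<bar>"]) (auto simp: coz_inf_abs[OF u])
  next
    case (UN K)
    then obtain S h where "S \<in> K" "M \<in> coz u h" "coz u h \<subseteq> S" by blast
    then show ?case by blast
  next
    case (Basis S)
    then show ?case by (auto simp: coz_eq[OF u])
  qed simp
qed

section \<open>Polars\<close>

lemma in_set_perp_perp_iff: "f \<in> set_perp (perp g) \<longleftrightarrow> (\<forall>h. inf \<bar>h\<bar> \<bar>g\<bar> = 0 \<longrightarrow> inf \<bar>f\<bar> \<bar>h\<bar> = 0)"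
  by (auto simp: set_perp_def perp_def)

text \<open>After rewriting with \<open>disj\<close>, membership in the double polar says that every
  cozero set missing \<open>coz u g\<close> also misses \<open>coz u f\<close>. As cozero sets form
  a base, this says that no point of \<open>coz u f\<close> has a neighbourhood missing
  \<open>coz u g\<close>.\<close>

lemma coz_subset_closure_iff:
  fixes f g u :: "'a::lattice_ab_group_add_abs"
  assumes arch: "archimedean_lgroup (UNIV :: 'a set) 0 (\<le>)" and u: "strong_unit u"
  shows "coz u f \<subseteq> hull_kernel_topology u closure_of coz u g \<longleftrightarrow> f \<in> set_perp (perp g)"
proof -
  note disj = inf_abs_eq_0_iff_coz[OF arch u]
  show ?thesis
    unfolding in_set_perp_perp_iff disj
  proof (intro iffI allI impI subsetI)
    fix h assume sub: "coz u f \<subseteq> hull_kernel_topology u closure_of coz u g"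
      and hg: "coz u h \<inter> coz u g = {}"
    show "coz u f \<inter> coz u h = {}"
    proof (rule ccontr)
      assume "coz u f \<inter> coz u h \<noteq> {}"
      then obtain M where "M \<in> coz u h" "M \<in> hull_kernel_topology u closure_of coz u g"
        using sub by blast
      then show False
        using hg openin_coz[OF u, of h] unfolding in_closure_of by blast
    qed
  next
    fix M assume perp: "\<forall>h. coz u h \<inter> coz u g = {} \<longrightarrow> coz u f \<inter> coz u h = {}"
      and M: "M \<in> coz u f"
    have "M \<in> topspace (hull_kernel_topology u)"
      using openin_subset[OF openin_coz[OF u]] M by blast
    moreover have "\<exists>N\<in>coz u g. N \<in> T" if T: "M \<in> T" "openin (hull_kernel_topology u) T" for T
    proof -
      obtain h where "M \<in> coz u h" "coz u h \<subseteq> T"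
        using coz_base[OF u T(2,1)] by blast
      then show ?thesis using perp M by blast
    qed
    ultimately show "M \<in> hull_kernel_topology u closure_of coz u g"
      unfolding in_closure_of by blast
  qed
qed

section \<open>Principal ideals compared with double polars\<close>

lemma principal_lideal_subset_perp_perp: "principal_lideal g \<subseteq> set_perp (perp g)"
proof
  fix f assume "f \<in> principal_lideal g"
  then obtain n where n: "\<bar>f\<bar> \<le> nat_mult n \<bar>g\<bar>"
    unfolding principal_lideal_def by blast
  have "inf \<bar>f\<bar> \<bar>h\<bar> = 0" if "inf \<bar>h\<bar> \<bar>g\<bar> = 0" for h
    using inf_nat_mult_eq_0[OF abs_ge_zero abs_ge_zero that, of n] n
    by (intro inf_eq_0_mono[of "nat_mult n \<bar>g\<bar>" "\<bar>h\<bar>" "\<bar>f\<bar>" "\<bar>h\<bar>", OF trans[OF inf_commute]]) simp_all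
  then show "f \<in> set_perp (perp g)"
    by (simp add: in_set_perp_perp_iff)
qed

lemma principal_eq_perp_perp_iff_d_ideal:
  "(\<forall>g::'a::lattice_ab_group_add_abs. principal_lideal g = set_perp (perp g)) \<longleftrightarrow>
    (\<forall>g::'a. d_ideal (principal_lideal g))"
  (is "?M \<longleftrightarrow> ?D")
proof
  assume M: ?M
  show ?D
    \<comment> \<open>With double polars rewritten to principal ideals, being a d-ideal only asks
      that an ideal contain G(h) for each of its elements h.\<close>
    unfolding d_ideal_def M[rule_format, symmetric]
    by (simp add: lideal_principal principal_lideal_subset)
next
  assume ?D
  then have "set_perp (perp g) \<subseteq> principal_lideal g" for g :: 'a
    using principal_lideal_self unfolding d_ideal_def by blast
  then show ?M
    using principal_lideal_subset_perp_perp by blast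
qed

lemma archimedean_quotient_perp_perp:
  fixes g :: "'a::lattice_ab_group_add_abs"
  assumes arch: "archimedean_lgroup (UNIV :: 'a set) 0 (\<le>)" and I: "lideal (set_perp (perp g))"
  shows "archimedean_lgroup (quotient_carrier (set_perp (perp g))) (set_perp (perp g)) quotient_le"
  unfolding archimedean_quotient_iff[OF I]
proof (intro allI impI, elim conjE)
  let ?I = "set_perp (perp g)"
  fix a b assume pos: "mod_le ?I 0 a" and bound: "\<forall>n>0. mod_le ?I (nat_mult n a) b"
  have a: "a = pprt a - pprt (- a)"
    using prts[of a] by (simp add: pprt_neg)
  \<comment> \<open>Since \<open>a\<close> is nonnegative modulo the polar, its negative part lies
    there and \<open>a\<close> may be replaced by \<open>pprt a\<close>.\<close>
  have neg: "pprt (- a) \<in> ?I"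
    using pos mod_le_iff_pprt[OF I, of 0 a] by simp
  then have "mod_le ?I (pprt a) a"
    unfolding mod_le_def using a by (metis diff_add_cancel order_refl)
  then have bound': "mod_le ?I (nat_mult n (pprt a)) b" if "0 < n" for n
    using bound that mod_le_trans[OF I mod_le_nat_mult[OF I]] by blast
  have "inf \<bar>pprt a\<bar> \<bar>h\<bar> = 0" if h: "inf \<bar>h\<bar> \<bar>g\<bar> = 0" for h
  proof -
    \<comment> \<open>Every multiple of \<open>c\<close> is disjoint from the error term
      \<open>m\<close>, because c \<le> \<bar>h\<bar>. The bound modulo the polar thus becomes a
      true bound by \<bar>b\<bar>, and the Archimedean property of the group gives c = 0.\<close>
    define c where "c = inf (pprt a) \<bar>h\<bar>"
    have c: "0 \<le> c" "c \<le> pprt a" "c \<le> \<bar>h\<bar>" by (simp_all add: c_def)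
    have "nat_mult n c \<le> \<bar>b\<bar>" if "0 < n" for n
    proof -
      obtain m where m: "m \<in> ?I" "nat_mult n (pprt a) \<le> b + m"
        using bound'[OF \<open>0 < n\<close>] unfolding mod_le_def by blast
      have "nat_mult n c \<le> nat_mult n (pprt a)"
        by (rule nat_mult_mono[OF c(2)])
      also have "\<dots> \<le> \<bar>b\<bar> + \<bar>m\<bar>"
        using m(2) add_mono[OF abs_ge_self abs_ge_self] by (rule order_trans)
      finally have "nat_mult n c = inf (nat_mult n c) (\<bar>b\<bar> + \<bar>m\<bar>)"
        by (simp add: inf_absorb1)
      also have "\<dots> \<le> inf (nat_mult n c) \<bar>b\<bar> + inf (nat_mult n c) \<bar>m\<bar>"
        by (rule inf_add_le) (simp_all add: c(1) nat_mult_nonneg)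
      also have "inf (nat_mult n c) \<bar>m\<bar> = 0"
      proof -
        have "inf \<bar>m\<bar> \<bar>h\<bar> = 0"
          using m(1) h by (simp add: in_set_perp_perp_iff)
        then have "inf \<bar>m\<bar> (nat_mult n c) = 0"
          using c by (intro inf_nat_mult_eq_0 inf_eq_0_mono[OF \<open>inf \<bar>m\<bar> \<bar>h\<bar> = 0\<close>]) simp_all
        then show ?thesis by (simp add: inf_commute)
      qed
      finally show ?thesis by simp
    qed
    then have "c = 0"
      using arch c(1) unfolding archimedean_lgroup_def by blast
    then show ?thesis by (simp add: c_def)
  qed
  then have "pprt a \<in> ?I"
    by (simp add: in_set_perp_perp_iff)
  then show "a \<in> ?I"
    using lideal_diff[OF I _ neg] a by metis
qed

text \<open>The element \<open>v\<close> is a weak unit: whatever is disjoint from it is disjoint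
  from \<open>g\<close>, hence from \<open>f\<close>, and from \<open>pprt (- x)\<close>, hence from
  \<open>u\<close>, which lies below n \<bar>f\<bar> + \<open>pprt (- x)\<close>.\<close>

lemma pprt_diff_unit_in_principal:
  fixes f g u :: "'a::lattice_ab_group_add_abs"
  assumes u: "strong_unit u" and f: "f \<in> set_perp (perp g)"
    and strong: "\<forall>v::'a. weak_unit v \<longrightarrow> strong_unit v"
  shows "pprt (nat_mult n \<bar>f\<bar> - u) \<in> principal_lideal g"
proof -
  define x where "x = nat_mult n \<bar>f\<bar> - u"
  define v where "v = \<bar>g\<bar> + pprt (- x)"
  have v: "0 \<le> v" by (simp add: v_def)
  have "h = 0" if "h \<in> perp v" for h
  proof -
    have hv: "inf \<bar>h\<bar> v = 0"
      using that v by (simp add: perp_def)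
    have "inf \<bar>h\<bar> \<bar>g\<bar> = 0" "inf \<bar>h\<bar> (pprt (- x)) = 0"
      by (rule inf_eq_0_mono[OF hv]; simp add: v_def)+
    then have "inf \<bar>h\<bar> \<bar>f\<bar> = 0"
      using f unfolding in_set_perp_perp_iff by (metis inf_commute)
    then have *: "inf \<bar>h\<bar> (nat_mult n \<bar>f\<bar> + pprt (- x)) = 0"
      by (intro inf_add_eq_0 inf_nat_mult_eq_0 nat_mult_nonneg \<open>inf \<bar>h\<bar> (pprt (- x)) = 0\<close>) simp_all
    have "u \<le> nat_mult n \<bar>f\<bar> + pprt (- x)"
      using add_left_mono[OF le_pprt[of "- x"], of "nat_mult n \<bar>f\<bar>"] by (simp add: x_def)
    then have hu: "inf \<bar>h\<bar> u = 0"
      using u by (intro inf_eq_0_mono[OF *]) (simp_all add: strong_unit_def)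
    obtain k where "\<bar>h\<bar> \<le> nat_mult k u"
      using strong_unit_bound[OF u] .
    then have "\<bar>h\<bar> = inf \<bar>h\<bar> (nat_mult k u)"
      by (simp add: inf_absorb1)
    also have "\<dots> = 0"
      using u by (intro inf_nat_mult_eq_0 hu) (simp_all add: strong_unit_def)
    finally show ?thesis by simp
  qed
  moreover have "0 \<in> perp v"
    by (simp add: perp_def inf_absorb1)
  ultimately have "weak_unit v"
    using v by (auto simp: weak_unit_def)
  then have "strong_unit v" using strong by blast
  then obtain k where k: "0 < k" "\<bar>pprt x\<bar> \<le> nat_mult k v"
    using strong_unit_bound by metis
  then have "pprt x \<le> nat_mult k \<bar>g\<bar> + nat_mult k (pprt (- x))"
    by (simp add: v_def nat_mult_distrib_left)
  \<comment> \<open>Of the bound by a multiple of \<open>v\<close>, only the part from \<bar>g\<bar>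
    survives, because \<open>pprt x\<close> is disjoint from \<open>pprt (- x)\<close>.\<close>
  then have "pprt x = inf (pprt x) (nat_mult k \<bar>g\<bar> + nat_mult k (pprt (- x)))"
    by (simp add: inf_absorb1)
  also have "\<dots> \<le> inf (pprt x) (nat_mult k \<bar>g\<bar>) + inf (pprt x) (nat_mult k (pprt (- x)))"
    by (rule inf_add_le) (simp_all add: nat_mult_nonneg)
  also have "inf (pprt x) (nat_mult k (pprt (- x))) = 0"
    by (simp add: inf_nat_mult_eq_0 inf_pprt_pprt_uminus)
  finally have "pprt x \<le> nat_mult k \<bar>g\<bar>" by simp
  then show ?thesis
    unfolding principal_lideal_def x_def using k(1) by auto
qed

lemma principal_eq_perp_perp_iff_archimedean:
  fixes u :: "'a::lattice_ab_group_add_abs"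
  assumes arch: "archimedean_lgroup (UNIV :: 'a set) 0 (\<le>)" and u: "strong_unit u"
  shows "(\<forall>g::'a. principal_lideal g = set_perp (perp g)) \<longleftrightarrow>
    (\<forall>g::'a. archimedean_lgroup (quotient_carrier (principal_lideal g)) (principal_lideal g) quotient_le)
      \<and> (\<forall>v::'a. weak_unit v \<longrightarrow> strong_unit v)" (is "?M \<longleftrightarrow> ?A \<and> ?W")
proof (intro iffI conjI)
  assume M: ?M
  show ?A
    \<comment> \<open>The hypothesis identifies each double polar with a principal ideal, which also
      shows that the polar is an ideal.\<close>
    using archimedean_quotient_perp_perp[OF arch] lideal_principal
    unfolding M[rule_format, symmetric] by blast
  \<comment> \<open>The polar of a weak unit is {0}, so its double polar, and with it the ideal that
    it generates, is the whole group.\<close>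
  have "set_perp {0} = (UNIV :: 'a set)"
    by (simp add: set_perp_def perp_def inf_absorb2)
  then show ?W
    using M by (simp add: weak_unit_def strong_unit_def)
next
  assume "?A \<and> ?W"
  then have A: ?A and W: ?W by auto
  have "f \<in> principal_lideal g" if f: "f \<in> set_perp (perp g)" for f g :: 'a
  proof -
    note I = lideal_principal[of g]
    have "mod_le (principal_lideal g) (nat_mult n \<bar>f\<bar>) u" for n
      using pprt_diff_unit_in_principal[OF u f W] by (simp add: mod_le_iff_pprt[OF I])
    moreover have "mod_le (principal_lideal g) 0 \<bar>f\<bar>"
      by (rule mod_le_if_le[OF I]) simp
    ultimately have "\<bar>f\<bar> \<in> principal_lideal g"
      using A archimedean_quotient_iff[OF I] by blast
    then show ?thesis by (simp add: lideal_abs_iff[OF I])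
  qed
  then show ?M
    using principal_lideal_subset_perp_perp by blast
qed

theorem corollary4p1:
  fixes u :: "'a::lattice_ab_group_add_abs"
  assumes "archimedean_lgroup (UNIV :: 'a set) 0 (\<le>)"
    and "strong_unit u"
  shows "((\<forall>g::'a. principal_lideal g = set_perp (perp g))
           \<longleftrightarrow> (\<forall>g::'a. d_ideal (principal_lideal g)))
       \<and> ((\<forall>g::'a. d_ideal (principal_lideal g))
           \<longleftrightarrow> (\<forall>f g::'a. coz u f \<subseteq> hull_kernel_topology u closure_of coz u g
                  \<longrightarrow> f \<in> principal_lideal g))
       \<and> ((\<forall>f g::'a. coz u f \<subseteq> hull_kernel_topology u closure_of coz u g
                  \<longrightarrow> f \<in> principal_lideal g)
           \<longleftrightarrow> (\<forall>g::'a. archimedean_lgroup (quotient_carrier (principal_lideal g))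
                           (principal_lideal g) quotient_le)
               \<and> (\<forall>v::'a. weak_unit v \<longrightarrow> strong_unit v))"
proof -
  have "(\<forall>g::'a. principal_lideal g = set_perp (perp g)) \<longleftrightarrow>
      (\<forall>f g::'a. coz u f \<subseteq> hull_kernel_topology u closure_of coz u g \<longrightarrow> f \<in> principal_lideal g)"
    \<comment> \<open>Condition (3) becomes the inclusion of each double polar in the principal
      ideal; the reverse inclusion always holds.\<close>
    unfolding coz_subset_closure_iff[OF assms] using principal_lideal_subset_perp_perp by blast
  then show ?thesis
    using principal_eq_perp_perp_iff_d_ideal principal_eq_perp_perp_iff_archimedean[OF assms] by metis
qed

end
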